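(* Let $R$ be a ring and let $U$ and $V$ be two $n\times n$ matrices with entries in $R$. Then $$\operatorname{col-det}(U+Q^{\rm col})=\langle 0|\operatorname{col-det}\big(a\,V+(1-a^\dagger)^{-1}U\big)|0\rangle,\qquad Q^{\rm col}_{ij}:=V_{ij}\,(n-j),$$ and $$\operatorname{row-det}(U+Q^{\rm row})=\langle 0|\operatorname{row-det}\big(a^\dagger V+(1-a)^{-1}U\big)|0\rangle,\qquad Q^{\rm row}_{ij}:=V_{ij}\,(i-1).$$
   Context: Rings are associative with unit, not necessarily commutative. For an $n\times n$ matrix $M$ over a noncommutative ring, with ordered products, $$\operatorname{col-det}M=\sum_{\sigma\in S_n}\operatorname{sgn}(\sigma)M_{\sigma(1)1}M_{\sigma(2)2}\cdots M_{\sigma(n)n},\qquad \operatorname{row-det}M=\sum_{\sigma\in S_n}\operatorname{sgn}(\sigma)M_{1\sigma(1)}M_{2\sigma(2)}\cdots M_{n\sigma(n)}.$$ Quantum oscillator: $a,a^\dagger$ satisfy $[a,a^\dagger]=1$, commute with all elements of $R$, and $a|0\rangle=0$, $\langle 0|a^\dagger=0$, $\langle0|0\rangle=1$. Concretely, for a word $w$ in $a,a^\dagger$, $\langle 0|w|0\rangle$ is the integer obtained by letting $a$ act as $d/dx$ and $a^\dagger$ as multiplication by $x$ on $\mathbb{Z}[x]$, applying $w$ to $1$ and taking the constant term; $\langle0|\cdot|0\rangle$ is extended $R$-linearly to (formal, possibly infinite) sums of words with coefficients in $R$. Here $(1-a^\dagger)^{-1}=\sum_{\nu\ge0}(a^\dagger)^\nu$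 and $(1-a)^{-1}=\sum_{\nu\ge0}a^\nu$ are formal geometric series; after expanding the determinants only finitely many words have nonzero expectation. *)

theory Defs
  imports "HOL-Combinatorics.Permutations" "HOL-Computational_Algebra.Polynomial"
begin

section \<open>Row- and column-determinants over noncommutative rings\<close>

text \<open>An $n \times n$ matrix is a function of two indices, only the entries with indices in
  \<open>{1..n}\<close> being relevant.  The factors are multiplied from left to right in the order of the list.\<close>

definition col_det :: "nat \<Rightarrow> (nat \<Rightarrow> nat \<Rightarrow> 'r::ring_1) \<Rightarrow> 'r" where
  "col_det n M =
     (\<Sum>\<sigma> | \<sigma> permutes {1..n}. of_int (sign \<sigma>) * prod_list (map (\<lambda>j. M (\<sigma> j) j) [1..<Suc n]))"

definition row_det :: "nat \<Rightarrow> (nat \<Rightarrow> nat \<Rightarrow> 'r::ring_1) \<Rightarrow> 'r" where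
  "row_det n M =
     (\<Sum>\<sigma> | \<sigma> permutes {1..n}. of_int (sign \<sigma>) * prod_list (map (\<lambda>i. M i (\<sigma> i)) [1..<Suc n]))"

section \<open>Formal series of words in the oscillator letters\<close>

text \<open>\<open>Ann\<close> stands for $a$ and \<open>Cre\<close> for $a^\dagger$.\<close>

datatype osc = Ann | Cre

text \<open>A series assigns a coefficient to every word; the first letter of the list is the leftmost
  factor.  The product concatenates words and multiplies coefficients, so the letters commute with
  the coefficients.  The relation $[a,a^\dagger] = 1$ is not imposed on the series, since infinite
  sums have no meaning modulo it; it holds for the operators by which the expectation below
  is computed.\<close>

typedef 'r osc_series = "UNIV :: (osc list \<Rightarrow> 'r) set"
  morphisms osc_nth Abs_osc_series
  by simp

setup_lifting type_definition_osc_series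

lemma osc_series_eqI: "(\<And>w. osc_nth f w = osc_nth g w) \<Longrightarrow> f = g"
  by transfer auto

instantiation osc_series :: (ring_1) ring_1
begin

lift_definition zero_osc_series :: "'a osc_series" is "\<lambda>w. 0" .

lift_definition one_osc_series :: "'a osc_series" is "\<lambda>w. if w = [] then 1 else 0" .

lift_definition plus_osc_series :: "'a osc_series \<Rightarrow> 'a osc_series \<Rightarrow> 'a osc_series"
  is "\<lambda>f g w. f w + g w" .

lift_definition minus_osc_series :: "'a osc_series \<Rightarrow> 'a osc_series \<Rightarrow> 'a osc_series"
  is "\<lambda>f g w. f w - g w" .

lift_definition uminus_osc_series :: "'a osc_series \<Rightarrow> 'a osc_series"
  is "\<lambda>f w. - f w" .

lift_definition times_osc_series :: "'a osc_series \<Rightarrow> 'a osc_series \<Rightarrow> 'a osc_series"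
  is "\<lambda>f g w. \<Sum>k\<le>length w. f (take k w) * g (drop k w)" .

instance
proof
  fix f g h :: "'a osc_series"
  show "f + g + h = f + (g + h)" by transfer (simp add: add.assoc)
  show "f + g = g + f" by transfer (simp add: add.commute)
  show "0 + f = f" by transfer simp
  show "- f + f = 0" by transfer simp
  show "f - g = f + - g" by transfer simp
  show "(f + g) * h = f * h + g * h"
    by transfer (simp add: distrib_right sum.distrib)
  show "f * (g + h) = f * g + f * h"
    by transfer (simp add: distrib_left sum.distrib)
  show "(0::'a osc_series) \<noteq> 1" by transfer (auto simp: fun_eq_iff)
  show "1 * f = f"
  proof (rule osc_series_eqI)
    fix w
    have "osc_nth (1 * f) w = (\<Sum>k\<le>length w. if k = 0 then osc_nth f w else 0)"
      by (simp only: times_osc_series.rep_eq one_osc_series.rep_eq) (rule sum.cong, auto)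
    then show "osc_nth (1 * f) w = osc_nth f w" by simp
  qed
  show "f * 1 = f"
  proof (rule osc_series_eqI)
    fix w
    have "osc_nth (f * 1) w = (\<Sum>k\<le>length w. if k = length w then osc_nth f w else 0)"
      by (simp only: times_osc_series.rep_eq one_osc_series.rep_eq) (rule sum.cong, auto)
    then show "osc_nth (f * 1) w = osc_nth f w" by simp
  qed
  show "f * g * h = f * (g * h)"
  proof (rule osc_series_eqI)
    fix w :: "osc list"
    let ?L = "length w"
    let ?t = "\<lambda>j i. osc_nth f (take j w) * osc_nth g (take (i - j) (drop j w)) * osc_nth h (drop i w)"
    have "osc_nth (f * g * h) w = (\<Sum>i\<le>?L. \<Sum>j\<le>i. ?t j i)"
      by (simp only: times_osc_series.rep_eq sum_distrib_right)
         (intro sum.cong, auto simp: min_def drop_take)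
    also have "\<dots> = (\<Sum>(i, j)\<in>(SIGMA i:{..?L}. {..i}). ?t j i)"
      by (simp add: sum.Sigma)
    also have "\<dots> = (\<Sum>(j, k)\<in>(SIGMA j:{..?L}. {..?L - j}). ?t j (k + j))"
      by (rule sum.reindex_bij_witness[where i = "\<lambda>(j, k). (k + j, j)" and j = "\<lambda>(i, j). (j, i - j)"])
         auto
    also have "\<dots> = (\<Sum>j\<le>?L. \<Sum>k\<le>?L - j. ?t j (k + j))"
      by (simp add: sum.Sigma)
    also have "\<dots> = osc_nth (f * (g * h)) w"
      by (simp only: times_osc_series.rep_eq sum_distrib_left)
         (intro sum.cong, auto simp: mult.assoc)
    finally show "osc_nth (f * g * h) w = osc_nth (f * (g * h)) w" .
  qed
qed

end

lift_definition osc_const :: "'r::ring_1 \<Rightarrow> 'r osc_series"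
  is "\<lambda>r w. if w = [] then r else 0" .

lift_definition osc_letter :: "osc \<Rightarrow> 'r::ring_1 osc_series"
  is "\<lambda>l w. if w = [l] then 1 else 0" .

lift_definition osc_geom :: "osc \<Rightarrow> 'r::ring_1 osc_series"
  is "\<lambda>l w. if \<exists>\<nu>. w = replicate \<nu> l then 1 else 0" .

lemma osc_letter_const_commute: "osc_letter l * osc_const r = osc_const r * osc_letter l"
proof (rule osc_series_eqI)
  fix w
  have "osc_nth (osc_letter l * osc_const r) w
      = (\<Sum>k\<le>length w. if k = length w then (if w = [l] then r else 0) else 0)"
    by (simp only: times_osc_series.rep_eq osc_letter.rep_eq osc_const.rep_eq) (rule sum.cong, auto)
  moreover have "osc_nth (osc_const r * osc_letter l) w
      = (\<Sum>k\<le>length w. if k = 0 then (if w = [l] then r else 0) else 0)"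
    by (simp only: times_osc_series.rep_eq osc_letter.rep_eq osc_const.rep_eq) (rule sum.cong, auto)
  ultimately show "osc_nth (osc_letter l * osc_const r) w = osc_nth (osc_const r * osc_letter l) w"
    by simp
qed

lemma osc_nth_letter_mult:
  "osc_nth (osc_letter l * f) w = (case w of [] \<Rightarrow> 0 | x # v \<Rightarrow> if x = l then osc_nth f v else 0)"
proof (cases w)
  case Nil
  then show ?thesis by (simp add: times_osc_series.rep_eq osc_letter.rep_eq)
next
  case (Cons x v)
  have "osc_nth (osc_letter l * f) w
      = (\<Sum>k\<le>length w. if k = 1 then (if x = l then osc_nth f v else 0) else 0)"
    unfolding times_osc_series.rep_eq osc_letter.rep_eq
  proof (rule sum.cong)
    fix k assume "k \<in> {..length w}"
    then show "(if take k w = [l] then 1 else 0) * osc_nth f (drop k w)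
        = (if k = 1 then (if x = l then osc_nth f v else 0) else 0)"
      using Cons by (cases k) (auto simp: take_Cons')
  qed simp
  then show ?thesis using Cons by (auto simp: Suc_le_eq)
qed

lemma osc_geom_inverse: "(1 - osc_letter l) * osc_geom l = (1 :: 'r::ring_1 osc_series)"
proof (rule osc_series_eqI)
  fix w
  have "(\<exists>\<nu>. x # v = replicate \<nu> l) \<longleftrightarrow> x = l \<and> (\<exists>\<nu>. v = replicate \<nu> l)" for x v
    by (metis Cons_replicate_eq replicate_Suc)
  then show "osc_nth ((1 - osc_letter l) * osc_geom l :: 'r osc_series) w = osc_nth (1 :: 'r osc_series) w"
    by (cases w) (auto simp: left_diff_distrib minus_osc_series.rep_eq osc_nth_letter_mult
        osc_geom.rep_eq one_osc_series.rep_eq)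
qed

section \<open>Vacuum expectation\<close>

fun osc_act :: "osc \<Rightarrow> int poly \<Rightarrow> int poly" where
  "osc_act Ann p = pderiv p"
| "osc_act Cre p = [:0, 1:] * p"

lemma osc_act_commutator: "osc_act Ann (osc_act Cre p) - osc_act Cre (osc_act Ann p) = p"
  by (simp add: pderiv_pCons)

definition word_vev :: "osc list \<Rightarrow> int" where
  "word_vev w = coeff (foldr osc_act w 1) 0"

definition vev_support :: "'r::ring_1 osc_series \<Rightarrow> osc list set" where
  "vev_support f = {w. osc_nth f w \<noteq> 0 \<and> word_vev w \<noteq> 0}"

text \<open>Meaningful only if \<open>vev_support f\<close> is finite; otherwise the sum is 0 by convention.\<close>

definition vev :: "'r::ring_1 osc_series \<Rightarrow> 'r" where
  "vev f = (\<Sum>w\<in>vev_support f. osc_nth f w * of_int (word_vev w))"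

end

theory Submission
  imports Defs
begin

text \<open>The identity holds term by term in the sum over permutations.  In the column determinant, if
  the last \<open>k\<close> factors of a term send the vacuum to \<open>(1 - x)\<^sup>-\<^sup>k C\<close>, then a further factor
  \<open>d/dx v + (1 - x)\<^sup>-\<^sup>1 u\<close> gives \<open>(1 - x)\<^sup>-\<^sup>k\<^sup>-\<^sup>1 (u + k v) C\<close>, and \<open>k = n - j\<close> for the
  \<open>j\<close>-th factor.  In the row determinant the dual states \<open>\<langle>0|(1 - a)\<^sup>-\<^sup>k\<close> play the same role
  from the left.  Only finitely many words contribute, because one of the two letters occurs at
  most \<open>n\<close> times and only balanced words have a nonzero expectation.\<close>

section \<open>Pairing series with weights on words\<close>

text \<open>The weight is kept arbitrary because removing a leftmost letter \<open>l\<close> from a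
  series turns \<open>g\<close> into \<open>\<lambda>w. g (l # w)\<close>, which is in general no
  longer the vacuum expectation.\<close>

definition pair_support :: "(osc list \<Rightarrow> int) \<Rightarrow> 'r::ring_1 osc_series \<Rightarrow> osc list set" where
  "pair_support g f = {w. osc_nth f w \<noteq> 0 \<and> g w \<noteq> 0}"

definition pairing :: "(osc list \<Rightarrow> int) \<Rightarrow> 'r::ring_1 osc_series \<Rightarrow> 'r" where
  "pairing g f = (\<Sum>w\<in>pair_support g f. osc_nth f w * of_int (g w))"

lemma vev_support_eq: "vev_support f = pair_support word_vev f"
  by (simp add: vev_support_def pair_support_def)

lemma vev_eq_pairing: "vev f = pairing word_vev f"
  by (simp add: vev_def pairing_def vev_support_eq)

text \<open>Words outside the support contribute 0, so pairings with different supports can be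
  compared over a common finite set.\<close>

lemma pairing_superset:
  assumes "finite A" "pair_support g f \<subseteq> A"
  shows "pairing g f = (\<Sum>w\<in>A. osc_nth f w * of_int (g w))"
  unfolding pairing_def using assms
  by (intro sum.mono_neutral_left) (auto simp: pair_support_def)

lemma pair_support_zero [simp]: "pair_support g 0 = {}"
  by (simp add: pair_support_def zero_osc_series.rep_eq)

lemma pairing_zero [simp]: "pairing g 0 = 0"
  by (simp add: pairing_def)

lemma pair_support_add: "pair_support g (f + h) \<subseteq> pair_support g f \<union> pair_support g h"
  by (auto simp: pair_support_def plus_osc_series.rep_eq)

lemma pairing_add:
  assumes "finite (pair_support g f)" "finite (pair_support g h)"
  shows "pairing g (f + h) = pairing g f + pairing g h"
proof -
  let ?A = "pair_support g f \<union> pair_support g h"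
  have "pairing g (f + h) = (\<Sum>w\<in>?A. osc_nth (f + h) w * of_int (g w))"
    using assms pair_support_add by (intro pairing_superset) auto
  also have "\<dots> = (\<Sum>w\<in>?A. osc_nth f w * of_int (g w)) + (\<Sum>w\<in>?A. osc_nth h w * of_int (g w))"
    by (simp add: plus_osc_series.rep_eq distrib_right sum.distrib)
  also have "\<dots> = pairing g f + pairing g h"
    using assms by (simp add: pairing_superset[where A = ?A])
  finally show ?thesis .
qed

lemma pair_support_sum:
  assumes "finite S" "\<And>s. s \<in> S \<Longrightarrow> finite (pair_support g (f s))"
  shows "finite (pair_support g (sum f S))"
  using assms by (induction S rule: finite_induct) (auto intro: finite_subset[OF pair_support_add])

lemma pairing_sum:
  assumes "finite S" "\<And>s. s \<in> S \<Longrightarrow> finite (pair_support g (f s))"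
  shows "pairing g (sum f S) = (\<Sum>s\<in>S. pairing g (f s))"
  using assms
  by (induction S rule: finite_induct) (simp_all add: pairing_add pair_support_sum)

section \<open>Left multiplication by constants, letters and geometric series\<close>

lemma osc_nth_const_mult: "osc_nth (osc_const r * f) w = r * osc_nth f w"
proof -
  have "osc_nth (osc_const r * f) w = (\<Sum>k\<le>length w. if k = 0 then r * osc_nth f w else 0)"
    by (simp only: times_osc_series.rep_eq osc_const.rep_eq) (rule sum.cong, auto)
  then show ?thesis by simp
qed

lemma pair_support_const_mult: "pair_support g (osc_const r * f) \<subseteq> pair_support g f"
  by (auto simp: pair_support_def osc_nth_const_mult)

lemma pairing_const_mult:
  assumes "finite (pair_support g f)"
  shows "pairing g (osc_const r * f) = r * pairing g f"
  using pairing_superset[OF assms pair_support_const_mult]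
  by (simp add: pairing_def osc_nth_const_mult sum_distrib_left mult.assoc)

lemma pair_support_letter_mult:
  "pair_support g (osc_letter l * f) = (#) l ` pair_support (\<lambda>w. g (l # w)) f"
proof (intro set_eqI)
  fix w
  show "w \<in> pair_support g (osc_letter l * f)
      \<longleftrightarrow> w \<in> (#) l ` pair_support (\<lambda>w. g (l # w)) f"
    by (cases w) (auto simp: pair_support_def osc_nth_letter_mult)
qed

lemma pairing_letter_mult: "pairing g (osc_letter l * f) = pairing (\<lambda>w. g (l # w)) f"
  by (simp add: pairing_def pair_support_letter_mult sum.reindex osc_nth_letter_mult)

lemma pairing_weight_scale: "pairing (\<lambda>w. k * g w) f = of_int k * pairing g f"
\<comment> \<open>For \<open>k \<noteq> 0\<close> the support is unchanged, as the integers have no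
  zero divisors; for \<open>k = 0\<close> it becomes empty.\<close>
proof (cases "k = 0")
  case False
  have "x * (of_int k * of_int (g w)) = of_int k * (x * of_int (g w))" for x :: 'a and w
    by (metis mult.assoc mult_of_int_commute)
  with False show ?thesis
    by (simp add: pairing_def pair_support_def sum_distrib_left)
qed (simp add: pairing_def pair_support_def)

lemma pairing_weight_diff:
  assumes "finite (pair_support g f)" "finite (pair_support h f)"
  shows "pairing (\<lambda>w. g w - h w) f = pairing g f - pairing h f"
proof -
  let ?A = "pair_support g f \<union> pair_support h f"
  have "pairing (\<lambda>w. g w - h w) f = (\<Sum>w\<in>?A. osc_nth f w * of_int (g w - h w))"
    using assms by (intro pairing_superset) (auto simp: pair_support_def)
  also have "\<dots> = (\<Sum>w\<in>?A. osc_nth f w * of_int (g w)) - (\<Sum>w\<in>?A. osc_nth f w * of_int (h w))"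
    by (simp add: right_diff_distrib sum_subtractf)
  also have "\<dots> = pairing g f - pairing h f"
    using assms by (simp add: pairing_superset[where A = ?A])
  finally show ?thesis .
qed

lemma osc_geom_mult: "osc_geom l * f = f + osc_letter l * (osc_geom l * f)"
proof -
  have "(1 - osc_letter l) * osc_geom l * f = f"
    by (simp add: osc_geom_inverse)
  then show ?thesis by (simp add: left_diff_distrib mult.assoc algebra_simps)
qed

text \<open>The geometric series enters only through its functional equation, so infinite sums are
  never expanded. Finiteness of both supports makes the pairing additive.\<close>

lemma pairing_geom_mult:
  assumes "finite (pair_support g f)" "finite (pair_support (\<lambda>w. g (l # w)) (osc_geom l * f))"
  shows "pairing g (osc_geom l * f) = pairing g f + pairing (\<lambda>w. g (l # w)) (osc_geom l * f)"
  by (subst osc_geom_mult)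
     (simp add: assms pairing_add pairing_letter_mult pair_support_letter_mult)

section \<open>Finiteness\<close>

text \<open>Finiteness is split into a condition on the series, stable under sums and products, and
  the condition \<open>letter_confined\<close> on the weight. The factor 2 there expresses that a
  word of nonzero weight has at most a constant number more of the other letter than of
  \<open>l\<close>.\<close>

definition letter_bounded :: "osc \<Rightarrow> 'r::ring_1 osc_series \<Rightarrow> bool" where
  "letter_bounded l f \<longleftrightarrow> (\<exists>N. \<forall>w. osc_nth f w \<noteq> 0 \<longrightarrow> count_list w l \<le> N)"

definition letter_confined :: "osc \<Rightarrow> (osc list \<Rightarrow> int) \<Rightarrow> bool" where
  "letter_confined l g \<longleftrightarrow> (\<exists>m. \<forall>w. g w \<noteq> 0 \<longrightarrow> length w \<le> 2 * count_list w l + m)"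

lemma finite_UNIV_osc: "finite (UNIV :: osc set)"
proof (rule finite_subset)
  show "UNIV \<subseteq> {Ann, Cre}" by (auto intro: osc.exhaust)
qed simp

text \<open>Contributing words have length at most \<open>2 * N + m\<close> over a two-letter
  alphabet.\<close>

lemma finite_pair_support:
  assumes "letter_bounded l f" "letter_confined l g"
  shows "finite (pair_support g f)"
proof -
  from assms obtain N m where
    "osc_nth f w \<noteq> 0 \<Longrightarrow> count_list w l \<le> N" "g w \<noteq> 0 \<Longrightarrow> length w \<le> 2 * count_list w l + m" for w
    unfolding letter_bounded_def letter_confined_def by blast
  then have "pair_support g f \<subseteq> {w. set w \<subseteq> UNIV \<and> length w \<le> 2 * N + m}"
    unfolding pair_support_def by (fastforce intro: order_trans)
  then show ?thesis
    using finite_lists_length_le[OF finite_UNIV_osc] finite_subset by blast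
qed

lemma letter_bounded_add:
  assumes "letter_bounded l f" "letter_bounded l g"
  shows "letter_bounded l (f + g)"
proof -
  from assms obtain M N where
    "osc_nth f w \<noteq> 0 \<Longrightarrow> count_list w l \<le> M" "osc_nth g w \<noteq> 0 \<Longrightarrow> count_list w l \<le> N" for w
    unfolding letter_bounded_def by blast
  then have "osc_nth (f + g) w \<noteq> 0 \<longrightarrow> count_list w l \<le> max M N" for w
    by (metis add.right_neutral max.coboundedI1 max.coboundedI2 plus_osc_series.rep_eq)
  then show ?thesis unfolding letter_bounded_def by blast
qed

lemma letter_bounded_mult:
  assumes "letter_bounded l f" "letter_bounded l g"
  shows "letter_bounded l (f * g)"
proof -
  from assms obtain M N where
    MN: "osc_nth f w \<noteq> 0 \<Longrightarrow> count_list w l \<le> M" "osc_nth g w \<noteq> 0 \<Longrightarrow> count_list w l \<le> N" for w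
    unfolding letter_bounded_def by blast
  have "count_list w l \<le> M + N" if nz: "osc_nth (f * g) w \<noteq> 0" for w
  proof -
    from nz obtain k where "osc_nth f (take k w) * osc_nth g (drop k w) \<noteq> 0"
      unfolding times_osc_series.rep_eq by (meson sum.not_neutral_contains_not_neutral)
    then have "osc_nth f (take k w) \<noteq> 0" "osc_nth g (drop k w) \<noteq> 0"
      by auto
    then have "count_list (take k w) l + count_list (drop k w) l \<le> M + N"
      using MN by (intro add_mono) auto
    then show ?thesis by (metis append_take_drop_id count_list_append)
  qed
  then show ?thesis unfolding letter_bounded_def by blast
qed

lemma letter_bounded_const: "letter_bounded l (osc_const r)"
  by (auto simp: letter_bounded_def osc_const.rep_eq intro!: exI[of _ 0])

lemma letter_bounded_letter: "letter_bounded l (osc_letter l')"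
  by (auto simp: letter_bounded_def osc_letter.rep_eq intro!: exI[of _ 1])

lemma letter_bounded_geom: "l \<noteq> l' \<Longrightarrow> letter_bounded l (osc_geom l')"
  by (auto simp: letter_bounded_def osc_geom.rep_eq count_list_0_iff intro!: exI[of _ 0])

lemma letter_bounded_one: "letter_bounded l 1"
  by (auto simp: letter_bounded_def one_osc_series.rep_eq intro!: exI[of _ 0])

lemma letter_bounded_prod_list:
  "(\<And>j. j \<in> set js \<Longrightarrow> letter_bounded l (f j)) \<Longrightarrow> letter_bounded l (prod_list (map f js))"
  by (induction js) (auto intro: letter_bounded_one letter_bounded_mult)

text \<open>Rewriting signs as constants lets \<open>pairing_const_mult\<close> move them out of the
  pairing.\<close>

lemma of_int_sign_eq_const: "(of_int (sign \<sigma>) :: 'r::ring_1 osc_series) = osc_const (of_int (sign \<sigma>))"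
proof -
  have "osc_const (1::'r) = 1" "osc_const (-1::'r) = - 1"
    by (transfer, auto)+
  then show ?thesis by (auto simp: sign_def)
qed

lemma
  assumes f: "\<And>\<sigma>. \<sigma> permutes {1..n::nat} \<Longrightarrow> letter_bounded l (f \<sigma>)" and g: "letter_confined l g"
  shows finite_pair_support_signed_sum:
      "finite (pair_support g (\<Sum>\<sigma> | \<sigma> permutes {1..n}. of_int (sign \<sigma>) * f \<sigma>))"
    and pairing_signed_sum:
      "pairing g (\<Sum>\<sigma> | \<sigma> permutes {1..n}. of_int (sign \<sigma>) * f \<sigma>)
        = (\<Sum>\<sigma> | \<sigma> permutes {1..n}. of_int (sign \<sigma>) * pairing g (f \<sigma>))"
proof -
  have fin: "finite (pair_support g (f \<sigma>))" if "\<sigma> permutes {1..n}" for \<sigma>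
    using finite_pair_support[OF f[OF that] g] .
  have fin': "finite (pair_support g (of_int (sign \<sigma>) * f \<sigma>))" if "\<sigma> permutes {1..n}" for \<sigma>
    unfolding of_int_sign_eq_const
    using fin[OF that] pair_support_const_mult by (rule rev_finite_subset)
  show "finite (pair_support g (\<Sum>\<sigma> | \<sigma> permutes {1..n}. of_int (sign \<sigma>) * f \<sigma>))"
    using fin' by (intro pair_support_sum) (auto simp: finite_permutations)
  have "pairing g (of_int (sign \<sigma>) * f \<sigma>) = of_int (sign \<sigma>) * pairing g (f \<sigma>)"
    if "\<sigma> permutes {1..n}" for \<sigma>
    unfolding of_int_sign_eq_const by (rule pairing_const_mult[OF fin[OF that]])
  then show "pairing g (\<Sum>\<sigma> | \<sigma> permutes {1..n}. of_int (sign \<sigma>) * f \<sigma>)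
        = (\<Sum>\<sigma> | \<sigma> permutes {1..n}. of_int (sign \<sigma>) * pairing g (f \<sigma>))"
    using fin' by (subst pairing_sum) (auto simp: finite_permutations)
qed

section \<open>Words acting on the vacuum\<close>

lemma length_eq_count: "length w = count_list w Ann + count_list w Cre"
proof (induction w)
  case (Cons x w)
  then show ?case by (cases x) auto
qed simp

text \<open>Each letter maps monomials to monomials and shifts the degree by one. The balance of
  letters is lost once a derivative hits a constant, hence the condition
  \<open>c \<noteq> 0\<close>.\<close>

lemma word_vacuum_monom:
  "\<exists>c d. foldr osc_act w 1 = monom c d \<and> (c \<noteq> 0 \<longrightarrow> count_list w Cre = count_list w Ann + d)"
proof (induction w)
  case Nil
  show ?case by (intro exI[of _ 1] exI[of _ 0]) (simp add: one_pCons monom_0)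
next
  case (Cons x w)
  then obtain c d where IH: "foldr osc_act w 1 = monom c d"
    "c \<noteq> 0 \<longrightarrow> count_list w Cre = count_list w Ann + d" by blast
  show ?case
  proof (cases x)
    case Ann
    \<comment> \<open>For \<open>d = 0\<close> the truncated \<open>d - 1\<close> is harmless, since
      the new coefficient is 0.\<close>
    then show ?thesis
      using IH by (intro exI[of _ "of_nat d * c"] exI[of _ "d - 1"]) (auto simp: pderiv_monom)
  next
    case Cre
    then show ?thesis
      using IH by (intro exI[of _ c] exI[of _ "Suc d"]) (auto simp: monom_Suc)
  qed
qed

text \<open>This is the functional \<open>\<langle>0|a^m/m!\<close>. All \<open>m\<close> are needed
  because \<open>Ann\<close> reads off the coefficient at \<open>Suc m\<close>.\<close>

definition coeff_weight :: "nat \<Rightarrow> osc list \<Rightarrow> int" where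
  "coeff_weight m w = coeff (foldr osc_act w 1) m"

lemma coeff_weight_0: "coeff_weight 0 = word_vev"
  by (simp add: fun_eq_iff coeff_weight_def word_vev_def)

lemma coeff_weight_Ann: "coeff_weight m (Ann # w) = int (Suc m) * coeff_weight (Suc m) w"
  by (simp add: coeff_weight_def coeff_pderiv)

lemma coeff_weight_Cre_0: "coeff_weight 0 (Cre # w) = 0"
  by (simp add: coeff_weight_def)

lemma coeff_weight_Cre_Suc: "coeff_weight (Suc m) (Cre # w) = coeff_weight m w"
  by (simp add: coeff_weight_def)

text \<open>A nonzero weight forces the monomial to have degree \<open>m\<close>, so the word has
  exactly \<open>m\<close> more \<open>Cre\<close> than \<open>Ann\<close>.\<close>

lemma coeff_weight_confined: "letter_confined Ann (coeff_weight m)"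
proof -
  have "length w \<le> 2 * count_list w Ann + m" if "coeff_weight m w \<noteq> 0" for w
    using that word_vacuum_monom[of w]
    by (auto simp: coeff_weight_def length_eq_count split: if_splits)
  then show ?thesis unfolding letter_confined_def by blast
qed

text \<open>The functional \<open>\<langle>0|(1 - a)\<^sup>-\<^sup>k\<close>, which sends \<open>x\<^sup>d\<close> to \<open>k (k+1) \<cdots> (k+d-1)\<close>.\<close>

definition dual_weight :: "nat \<Rightarrow> osc list \<Rightarrow> int" where
  "dual_weight k w =
     (let p = foldr osc_act w 1 in \<Sum>d\<le>degree p. pochhammer (int k) d * coeff p d)"

lemma dual_weight_monom:
  assumes "foldr osc_act w 1 = monom c d"
  shows "dual_weight k w = pochhammer (int k) d * c"
proof (cases "c = 0")
  case False
  then have "dual_weight k w = (\<Sum>i\<le>d. if i = d then pochhammer (int k) d * c else 0)"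
    unfolding dual_weight_def assms by (simp add: degree_monom_eq if_distrib cong: if_cong)
  then show ?thesis by simp
qed (simp add: dual_weight_def assms)

lemma dual_weight_0: "dual_weight 0 = word_vev"
proof
  fix w
  obtain c d where "foldr osc_act w 1 = monom c d"
    using word_vacuum_monom by blast
  then show "dual_weight 0 w = word_vev w"
    by (cases d) (auto simp: dual_weight_monom word_vev_def pochhammer_rec)
qed

lemma dual_weight_Nil: "dual_weight k [] = 1"
  by (simp add: dual_weight_def)

text \<open>Commuting the creation operator to the left past \<open>(1 - a)^(-k)\<close> leaves
  \<open>k (1 - a)^(-k-1)\<close>, and it annihilates the dual vacuum. On monomials this is the
  recursion of the Pochhammer symbol.\<close>

lemma dual_weight_Cre: "dual_weight k (Cre # w) = int k * dual_weight (Suc k) w"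
proof -
  obtain c d where w: "foldr osc_act w 1 = monom c d"
    using word_vacuum_monom by blast
  then have "foldr osc_act (Cre # w) 1 = monom c (Suc d)"
    by (simp add: monom_Suc)
  with w show ?thesis by (simp add: dual_weight_monom pochhammer_rec add.commute)
qed

text \<open>In operator form: \<open>(1 - a)^(-k-1) (1 - a) = (1 - a)^(-k)\<close>.\<close>

lemma dual_weight_Ann: "dual_weight (Suc k) w - dual_weight (Suc k) (Ann # w) = dual_weight k w"
proof -
  obtain c d where w: "foldr osc_act w 1 = monom c d"
    using word_vacuum_monom by blast
  then have w': "foldr osc_act (Ann # w) 1 = monom (int d * c) (d - 1)"
    by (simp add: pderiv_monom)
  show ?thesis
  proof (cases d)
    case (Suc e)
    have "pochhammer (int (Suc k)) (Suc e) - int (Suc e) * pochhammer (int (Suc k)) e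
        = int k * pochhammer (int (Suc k)) e"
      by (simp add: pochhammer_Suc algebra_simps)
    also have "\<dots> = pochhammer (int k) (Suc e)"
      by (simp add: pochhammer_rec add.commute)
    finally have "(pochhammer (int (Suc k)) (Suc e) - int (Suc e) * pochhammer (int (Suc k)) e) * c
        = pochhammer (int k) (Suc e) * c" by simp
    with w w' Suc show ?thesis
      by (simp add: dual_weight_monom left_diff_distrib mult.assoc mult.left_commute)
  qed (use w w' in \<open>simp add: dual_weight_monom\<close>)
qed

text \<open>A nonzero image of the vacuum has nonnegative degree, so \<open>Cre\<close> occurs at
  least as often as \<open>Ann\<close>.\<close>

lemma dual_weight_confined: "letter_confined Cre (dual_weight k)"
proof -
  have "length w \<le> 2 * count_list w Cre + 0" if nz: "dual_weight k w \<noteq> 0" for w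
  proof -
    obtain c d where "foldr osc_act w 1 = monom c d"
      "c \<noteq> 0 \<longrightarrow> count_list w Cre = count_list w Ann + d"
      using word_vacuum_monom by blast
    with nz show ?thesis by (auto simp: dual_weight_monom length_eq_count)
  qed
  then show ?thesis unfolding letter_confined_def by blast
qed

lemma letter_confined_Cons:
  assumes "letter_confined l g"
  shows "letter_confined l (\<lambda>w. g (x # w))"
proof -
  from assms obtain m where "g w \<noteq> 0 \<Longrightarrow> length w \<le> 2 * count_list w l + m" for w
    unfolding letter_confined_def by blast
  then have "g (x # w) \<noteq> 0 \<longrightarrow> length w \<le> 2 * count_list w l + (m + 2)" for w
    by (fastforce split: if_splits)
  then show ?thesis unfolding letter_confined_def by blast
qed

section \<open>Vacuum expectation of ordered products\<close>

text \<open>The coefficient of \<open>x\<^sup>m\<close> in \<open>(1 - x)\<^sup>-\<^sup>k\<close>; truncated subtraction gives the right value also for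
  \<open>k = 0\<close>.\<close>

definition neg_binom :: "nat \<Rightarrow> nat \<Rightarrow> nat" where
  "neg_binom k m = (k + m - 1) choose m"

lemma neg_binom_0_right [simp]: "neg_binom k 0 = 1"
  by (simp add: neg_binom_def)

lemma neg_binom_0_left: "neg_binom 0 m = (if m = 0 then 1 else 0)"
  by (simp add: neg_binom_def)

text \<open>Pascal's rule, the coefficient form of
  \<open>(1 - x) (1 - x)^(-k-1) = (1 - x)^(-k)\<close>.\<close>

lemma neg_binom_Suc_Suc: "neg_binom (Suc k) (Suc m) = neg_binom k (Suc m) + neg_binom (Suc k) m"
  by (simp add: neg_binom_def)

text \<open>The coefficient form of \<open>d/dx (1 - x)^(-k) = k (1 - x)^(-k-1)\<close>.\<close>

lemma neg_binom_deriv: "Suc m * neg_binom k (Suc m) = k * neg_binom (Suc k) m"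
  using binomial_absorption[of m "k + m"] binomial_absorb_comp[of "k + m" m]
  by (simp add: neg_binom_def del: mult_Suc)

section \<open>A single factor of an ordered product\<close>

definition col_factor :: "'r::ring_1 \<Rightarrow> 'r \<Rightarrow> 'r osc_series" where
  "col_factor u v = osc_letter Ann * osc_const v + osc_geom Cre * osc_const u"

definition row_factor :: "'r::ring_1 \<Rightarrow> 'r \<Rightarrow> 'r osc_series" where
  "row_factor u v = osc_letter Cre * osc_const v + osc_geom Ann * osc_const u"

lemma letter_bounded_col_factor: "letter_bounded Ann (col_factor u v)"
  unfolding col_factor_def
  by (intro letter_bounded_add letter_bounded_mult letter_bounded_const letter_bounded_letter
      letter_bounded_geom) simp

lemma letter_bounded_row_factor: "letter_bounded Cre (row_factor u v)"
  unfolding row_factor_def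
  by (intro letter_bounded_add letter_bounded_mult letter_bounded_const letter_bounded_letter
      letter_bounded_geom) simp

text \<open>The second hypothesis says that \<open>f\<close> sends the vacuum to
  \<open>(1 - x)^(-k) c\<close>. Since \<open>Cre\<close> lowers the coefficient index, the
  functional equation of the geometric series becomes a recursion on \<open>m\<close>, solved by
  Pascal's rule.\<close>

lemma pairing_geom_Cre:
  assumes "letter_bounded Ann f" "\<And>m. pairing (coeff_weight m) f = of_nat (neg_binom k m) * c"
  shows "pairing (coeff_weight m) (osc_geom Cre * f) = of_nat (neg_binom (Suc k) m) * c"
proof -
  have "letter_bounded Ann (osc_geom Cre * f)"
    using assms(1) by (intro letter_bounded_mult letter_bounded_geom) auto
  then have step: "pairing (coeff_weight m) (osc_geom Cre * f)
      = pairing (coeff_weight m) f + pairing (\<lambda>w. coeff_weight m (Cre # w)) (osc_geom Cre * f)" for m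
    using assms(1) coeff_weight_confined
    by (intro pairing_geom_mult finite_pair_support[of Ann] letter_confined_Cons)
  show ?thesis
  proof (induction m)
    case 0
    show ?case
      \<comment> \<open>The second \<open>simp\<close> removes a pairing with the zero weight: no
        multiple of \<open>x\<close> has a constant term.\<close>
      by (simp add: step[of 0] coeff_weight_Cre_0 assms(2)) (simp add: pairing_def pair_support_def)
  next
    case (Suc m)
    then show ?case
      by (simp add: step[of "Suc m"] coeff_weight_Cre_Suc assms(2) neg_binom_Suc_Suc distrib_right)
  qed
qed

text \<open>Differentiation contributes \<open>k v\<close> and the geometric series
  \<open>u\<close>, both with the same power \<open>(1 - x)^(-k-1)\<close>. The state coefficient
  \<open>c\<close> stays on the right, and only the central integer \<open>k\<close> is moved past
  \<open>v\<close>.\<close>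

lemma pairing_col_factor:
  assumes f: "letter_bounded Ann f"
    and pf: "\<And>m. pairing (coeff_weight m) f = of_nat (neg_binom k m) * c"
  shows "pairing (coeff_weight m) (col_factor u v * f)
    = of_nat (neg_binom (Suc k) m) * ((u + v * of_nat k) * c)"
proof -
  have const: "letter_bounded Ann (osc_const r * f)"
    "pairing (coeff_weight m) (osc_const r * f) = of_nat (neg_binom k m) * (r * c)" for r m
    using f coeff_weight_confined
    by (simp_all add: letter_bounded_mult letter_bounded_const pairing_const_mult
        finite_pair_support pf) (metis mult.assoc mult_of_nat_commute)
  have fin: "finite (pair_support (coeff_weight m) (osc_letter Ann * (osc_const v * f)))"
    "finite (pair_support (coeff_weight m) (osc_geom Cre * (osc_const u * f)))"
    by (intro finite_pair_support[of Ann] coeff_weight_confined letter_bounded_mult const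
        letter_bounded_letter letter_bounded_geom letter_bounded_const f; simp)+
  have "pairing (coeff_weight m) (osc_letter Ann * (osc_const v * f))
      = of_nat (Suc m * neg_binom k (Suc m)) * (v * c)"
    by (simp only: pairing_letter_mult coeff_weight_Ann pairing_weight_scale const
        of_nat_mult mult.assoc of_int_of_nat_eq)
  also have "\<dots> = of_nat (neg_binom (Suc k) m) * (of_nat k * v * c)"
    by (simp only: neg_binom_deriv mult.commute[of k] of_nat_mult mult.assoc)
  finally have "pairing (coeff_weight m) (col_factor u v * f)
      = of_nat (neg_binom (Suc k) m) * (of_nat k * v * c) + of_nat (neg_binom (Suc k) m) * (u * c)"
    using fin
    by (simp add: col_factor_def distrib_right mult.assoc pairing_add pairing_geom_Cre[OF const])
  then show ?thesis
    by (simp add: distrib_left distrib_right mult_of_nat_commute add.commute)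
qed

text \<open>Here the factor is absorbed into the functional on its left: both \<open>Cre\<close> and
  the geometric series turn \<open>dual_weight k\<close> into \<open>dual_weight (Suc k)\<close>,
  with coefficients \<open>k\<close> and 1.\<close>

lemma pairing_row_factor:
  assumes f: "letter_bounded Cre f"
  shows "pairing (dual_weight k) (row_factor u v * f)
    = (u + v * of_nat k) * pairing (dual_weight (Suc k)) f"
proof -
  have fin: "finite (pair_support (dual_weight k) (osc_const r * f))" for r k
    using f by (intro finite_pair_support[OF _ dual_weight_confined] letter_bounded_mult
      letter_bounded_const)
  have fin': "finite (pair_support (dual_weight k) (osc_letter Cre * (osc_const v * f)))"
    by (intro finite_pair_support[OF _ dual_weight_confined] letter_bounded_mult
      letter_bounded_letter letter_bounded_const f)
  have geom: "letter_bounded Cre (osc_geom Ann * (osc_const u * f))"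
    by (intro letter_bounded_mult letter_bounded_geom letter_bounded_const f) simp
  note fin_geom = finite_pair_support[OF geom dual_weight_confined]
    finite_pair_support[OF geom letter_confined_Cons[OF dual_weight_confined]]
  \<comment> \<open>Writing the weight as a difference makes the functional equation of the
    geometric series cancel everything but its first term.\<close>
  have "pairing (dual_weight k) (osc_geom Ann * (osc_const u * f))
      = pairing (\<lambda>w. dual_weight (Suc k) w - dual_weight (Suc k) (Ann # w))
          (osc_geom Ann * (osc_const u * f))"
    by (simp add: dual_weight_Ann)
  also have "\<dots> = pairing (dual_weight (Suc k)) (osc_const u * f)"
    by (simp add: pairing_weight_diff fin_geom pairing_geom_mult[OF fin])
  finally have "pairing (dual_weight k) (row_factor u v * f)
      = of_nat k * (v * pairing (dual_weight (Suc k)) f) + u * pairing (dual_weight (Suc k)) f"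
    using fin' fin_geom finite_pair_support[OF f dual_weight_confined]
    by (simp add: row_factor_def distrib_right mult.assoc pairing_add pairing_letter_mult
        dual_weight_Cre pairing_weight_scale pairing_const_mult)
  then show ?thesis
    by (simp add: distrib_right mult.assoc[symmetric] mult_of_nat_commute add.commute)
qed

section \<open>Complete ordered products\<close>

lemma pairing_one: "pairing g 1 = of_int (g [])"
  by (subst pairing_superset[of "{[]}"]) (auto simp: pair_support_def one_osc_series.rep_eq)

text \<open>Downward induction on \<open>j\<close> lets the factors act on the vacuum from right to
  left, starting with the empty product and exponent 0. The index \<open>m\<close> varies because
  differentiation shifts it.\<close>

lemma pairing_col_prod:
  assumes "j \<le> Suc n"
  shows "pairing (coeff_weight m) (prod_list (map (\<lambda>j. col_factor (u j) (v j)) [j..<Suc n]))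
    = of_nat (neg_binom (Suc n - j) m)
        * prod_list (map (\<lambda>j. u j + v j * of_int (int n - int j)) [j..<Suc n])"
  using assms
proof (induction arbitrary: m rule: inc_induct)
  case base
  show ?case by (simp add: pairing_one coeff_weight_def neg_binom_0_left)
next
  case (step j)
  from step.hyps have upt: "[j..<Suc n] = j # [Suc j..<Suc n]" and "j \<le> n"
    by (simp_all add: upt_conv_Cons del: upt_Suc)
  \<comment> \<open>Factor \<open>j\<close> meets a state with exponent \<open>n - j\<close>; by
    \<open>j \<le> n\<close> this natural number agrees with the integer in the correction
    term.\<close>
  then have "of_nat (n - j) = (of_int (int n - int j) :: 'a)" "Suc n - j = Suc (n - j)"
    by (simp_all add: of_nat_diff)
  moreover have "letter_bounded Ann (prod_list (map (\<lambda>j. col_factor (u j) (v j)) [Suc j..<Suc n]))"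
    by (intro letter_bounded_prod_list letter_bounded_col_factor)
  ultimately show ?case
    using pairing_col_factor[OF _ step.IH[unfolded diff_Suc_Suc]] unfolding upt by simp
qed

text \<open>The weight index \<open>i\<close> counts the rows already absorbed from the left, so row
  \<open>Suc i\<close> receives the correction \<open>i\<close>. After all rows, the functional is
  evaluated at the empty word.\<close>

lemma pairing_row_prod:
  assumes "i \<le> n"
  shows "pairing (dual_weight i) (prod_list (map (\<lambda>i. row_factor (u i) (v i)) [Suc i..<Suc n]))
    = prod_list (map (\<lambda>i. u i + v i * of_int (int i - 1)) [Suc i..<Suc n])"
  using assms
proof (induction rule: inc_induct)
  case base
  show ?case by (simp add: pairing_one dual_weight_Nil)
next
  case (step i)
  from step.hyps have upt: "[Suc i..<Suc n] = Suc i # [Suc (Suc i)..<Suc n]"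
    by (simp add: upt_conv_Cons del: upt_Suc)
  have "letter_bounded Cre (prod_list (map (\<lambda>i. row_factor (u i) (v i)) [Suc (Suc i)..<Suc n]))"
    by (intro letter_bounded_prod_list letter_bounded_row_factor)
  from pairing_row_factor[OF this] step.IH show ?case
    unfolding upt by simp
qed

theorem proposition1p3:
  fixes U V :: "nat \<Rightarrow> nat \<Rightarrow> 'r::ring_1" and n :: nat
  shows
    "(let Qcol = (\<lambda>i j. V i j * of_int (int n - int j));
          D = col_det n (\<lambda>i j. osc_letter Ann * osc_const (V i j) + osc_geom Cre * osc_const (U i j))
      in finite (vev_support D) \<and> col_det n (\<lambda>i j. U i j + Qcol i j) = vev D) \<and>
     (let Qrow = (\<lambda>i j. V i j * of_int (int i - 1));
          D = row_det n (\<lambda>i j. osc_letter Cre * osc_const (V i j) + osc_geom Ann * osc_const (U i j))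
      in finite (vev_support D) \<and> row_det n (\<lambda>i j. U i j + Qrow i j) = vev D)"
proof -
  have bounded:
    "letter_bounded Ann (prod_list (map (\<lambda>j. col_factor (U (\<sigma> j) j) (V (\<sigma> j) j)) [1..<Suc n]))"
    "letter_bounded Cre (prod_list (map (\<lambda>i. row_factor (U i (\<sigma> i)) (V i (\<sigma> i))) [1..<Suc n]))"
    for \<sigma> :: "nat \<Rightarrow> nat"
    by (intro letter_bounded_prod_list letter_bounded_col_factor letter_bounded_row_factor)+
  \<comment> \<open>The vacuum expectation is the member with index 0 of both families of weights,
    hence confined by either letter.\<close>
  have confined: "letter_confined Ann word_vev" "letter_confined Cre word_vev"
    using coeff_weight_confined[of 0] dual_weight_confined[of 0]
    by (simp_all only: coeff_weight_0 dual_weight_0)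
  have col:
    "pairing word_vev (prod_list (map (\<lambda>j. col_factor (U (\<sigma> j) j) (V (\<sigma> j) j)) [1..<Suc n]))
      = prod_list (map (\<lambda>j. U (\<sigma> j) j + V (\<sigma> j) j * of_int (int n - int j)) [1..<Suc n])" for \<sigma>
    \<comment> \<open>At \<open>m = 0\<close> the scalar \<open>neg_binom n 0\<close> is 1.\<close>
    using pairing_col_prod[of 1 n 0 "\<lambda>j. U (\<sigma> j) j" "\<lambda>j. V (\<sigma> j) j"]
    by (simp add: coeff_weight_0 del: upt_Suc)
  have row:
    "pairing word_vev (prod_list (map (\<lambda>i. row_factor (U i (\<sigma> i)) (V i (\<sigma> i))) [1..<Suc n]))
      = prod_list (map (\<lambda>i. U i (\<sigma> i) + V i (\<sigma> i) * of_int (int i - 1)) [1..<Suc n])" for \<sigma>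
    using pairing_row_prod[of 0 n "\<lambda>i. U i (\<sigma> i)" "\<lambda>i. V i (\<sigma> i)"]
    by (simp add: dual_weight_0 del: upt_Suc)
  show ?thesis
    unfolding Let_def col_det_def row_det_def vev_support_eq vev_eq_pairing
      col_factor_def[symmetric] row_factor_def[symmetric]
    by (intro conjI finite_pair_support_signed_sum[OF bounded(1) confined(1)]
        finite_pair_support_signed_sum[OF bounded(2) confined(2)])
      (simp_all only: pairing_signed_sum[OF bounded(1) confined(1)] col
        pairing_signed_sum[OF bounded(2) confined(2)] row)
qed

end
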